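(* The set $V=\{1,2,\dots,29,31,90\}$, which has $n-1=31$ elements with $n=32$, is tight, i.e. $\mathrm{LR}(V)=\frac1{32}$, and its largest speed is $90>2n$.
   Context: $\lVert x\rVert$ denotes the distance from the real number $x$ to the nearest integer. For a set $V$ of $n-1$ distinct positive integers (speeds), $\mathrm{LR}(V)=\max_{t\in[0,1)}\min_{v\in V}\lVert vt\rVert$, and $V$ is called tight if $\mathrm{LR}(V)=\frac1n$. *)

theory Defs
  imports "HOL-Analysis.Analysis"
begin

definition dist_int :: "real \<Rightarrow> real" where
  "dist_int x = infdist x \<int>"

definition speed_set :: "nat \<Rightarrow> nat set \<Rightarrow> bool" where
  "speed_set n V \<longleftrightarrow> finite V \<and> (\<forall>v\<in>V. 0 < v) \<and> card V + 1 = n"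

(* GREATEST is the maximum of the set of values, so LR V is specified only when that maximum
   is attained; LR_attained below shows that it is, for every finite nonempty V. *)
definition LR :: "nat set \<Rightarrow> real" where
  "LR V = (GREATEST m. \<exists>t\<in>{0..<1::real}. m = (MIN v\<in>V. dist_int (real v * t)))"

definition tight :: "nat \<Rightarrow> nat set \<Rightarrow> bool" where
  "tight n V \<longleftrightarrow> speed_set n V \<and> LR V = 1 / real n"

lemma dist_int_eq_round: "dist_int x = \<bar>x - of_int (round x)\<bar>"
proof (rule antisym)
  show "dist_int x \<le> \<bar>x - of_int (round x)\<bar>"
    unfolding dist_int_def using infdist_le[of "of_int (round x)" \<int> x] by (simp add: dist_real_def)
  have "\<bar>x - of_int (round x)\<bar> \<le> dist x a" if "a \<in> \<int>" for a
  proof -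
    from that obtain k where "a = of_int k" by (auto elim: Ints_cases)
    then show ?thesis
      using round_diff_minimal[of x k] by (simp add: dist_real_def abs_minus_commute)
  qed
  moreover have "(\<int> :: real set) \<noteq> {}" by blast
  ultimately show "\<bar>x - of_int (round x)\<bar> \<le> dist_int x"
    unfolding dist_int_def infdist_def by (auto intro!: cINF_greatest)
qed

lemma continuous_on_Min_dist_int:
  assumes "finite V" "V \<noteq> {}"
  shows "continuous_on S (\<lambda>t. MIN v\<in>V. dist_int (real v * t))"
  using assms
proof (induction V rule: finite_ne_induct)
  case (singleton v)
  then show ?case by (auto simp: dist_int_def intro!: continuous_intros)
next
  case (insert v F)
  have "(\<lambda>t. MIN w\<in>insert v F. dist_int (real w * t))
      = (\<lambda>t. min (dist_int (real v * t)) (MIN w\<in>F. dist_int (real w * t)))"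
    using insert by simp
  moreover have "continuous_on S (\<lambda>t. dist_int (real v * t))"
    by (auto simp: dist_int_def intro!: continuous_intros)
  ultimately show ?case using insert by (auto intro!: continuous_intros)
qed

lemma LR_attained:
  assumes "finite V" "V \<noteq> {}"
  shows "\<exists>t\<in>{0..<1}. LR V = (MIN v\<in>V. dist_int (real v * t))"
    and "\<And>t. t \<in> {0..<1} \<Longrightarrow> (MIN v\<in>V. dist_int (real v * t)) \<le> LR V"
proof -
  define f where "f t = (MIN v\<in>V. dist_int (real v * t))" for t :: real
  have per: "f 1 = f 0"
    by (simp add: f_def dist_int_eq_round)
  have "\<exists>t\<in>{0..1}. \<forall>s\<in>{0..1}. f s \<le> f t"
    unfolding f_def using assms
    by (intro continuous_attains_sup continuous_on_Min_dist_int) auto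
  then obtain t where t: "t \<in> {0..1}" "\<forall>s\<in>{0..1}. f s \<le> f t" by blast
  define u where "u = (if t = 1 then 0 else t)"
  have u: "u \<in> {0..<1}" "\<And>s. s \<in> {0..<1} \<Longrightarrow> f s \<le> f u"
    using t per by (auto simp: u_def)
  have "LR V = f u"
    unfolding LR_def f_def[symmetric] by (rule Greatest_equality) (use u in auto)
  then show "\<exists>t\<in>{0..<1}. LR V = (MIN v\<in>V. dist_int (real v * t))"
    and "\<And>t. t \<in> {0..<1} \<Longrightarrow> (MIN v\<in>V. dist_int (real v * t)) \<le> LR V"
    using u by (auto simp: f_def)
qed

end

(* If some v t with v in {1,...,31} other than 30 is within 1/32 of an integer, nothing is left to
   do. By Dirichlet's theorem the remaining case is 30 t = m + e with |e| <= 1/32, and by symmetry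
   e >= 0. If e <= 1/96, the speed 90 = 3 * 30 works. If m and 30 have a common factor g > 1, the
   speed 30/g works. Otherwise let v m = -1 (mod 30), so that v t differs from an integer by
   (v e - 1)/30, which is at most 1/32 in absolute value as soon as 1/16 <= v e <= 31/16. Since
   1/96 < e <= 1/32, any v between 6 and 62 will do. The units modulo 30 are 1 and numbers between
   7 and 29, so v can be taken in {7,...,29}, or equal to 31 in place of 1. *)
theory Submission
  imports Defs
begin

lemma dist_int_le:
  assumes "\<bar>x - of_int k\<bar> \<le> c"
  shows "dist_int x \<le> c"
  using assms round_diff_minimal[of x k] by (simp add: dist_int_eq_round)

lemma dist_int_minus: "dist_int (- x) = dist_int x"
proof (rule antisym)
  show "dist_int (- x) \<le> dist_int x"
    by (rule dist_int_le[where k = "- round x"]) (simp add: dist_int_eq_round)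
  show "dist_int x \<le> dist_int (- x)"
    by (rule dist_int_le[where k = "- round (- x)"]) (simp add: dist_int_eq_round)
qed

text \<open>The difference from the nearest integer is a nonzero integer divided by
  \<open>n\<close>. This gives the lower bound on \<open>LR\<close> at the time
  \<open>1 / 32\<close>.\<close>

lemma dist_int_fraction_ge:
  fixes v n :: nat
  assumes "0 < n" "\<not> n dvd v"
  shows "1 / real n \<le> dist_int (real v / real n)"
proof -
  define d where "d = int v - int n * round (real v / real n)"
  have "d \<noteq> 0"
    using assms(2) by (metis d_def dvd_triv_left eq_iff_diff_eq_0 int_dvd_int_iff)
  then have "1 \<le> \<bar>real_of_int d\<bar>"
    by linarith
  moreover have "real v / real n - of_int (round (real v / real n)) = real_of_int d / real n"
    using assms(1) by (simp add: d_def field_simps)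
  ultimately show ?thesis
    using assms(1) by (simp add: dist_int_eq_round divide_right_mono)
qed

text \<open>The library version \<open>Dirichlet_approx\<close> only gives the bound \<open>1 / N\<close>.\<close>
lemma Dirichlet_approx_Suc:
  fixes t :: real and N :: nat
  assumes "0 < N"
  obtains k m where "k \<in> {1..N}" "\<bar>real k * t - of_int m\<bar> \<le> 1 / real (Suc N)"
proof -
  \<comment> \<open>Pigeonhole set-up: \<open>[0, 1)\<close> is cut into \<open>N + 1\<close> boxes
    of length \<open>1 / (N + 1)\<close>, and \<open>b k\<close> is the index of the box containing
    the fractional part of \<open>k * t\<close>.\<close>
  define b where "b k = nat \<lfloor>real (Suc N) * frac (real k * t)\<rfloor>" for k
  have b_le: "real (b k) \<le> real (Suc N) * frac (real k * t)"
    and b_gt: "real (Suc N) * frac (real k * t) < real (b k) + 1" for k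
  proof -
    have "0 \<le> real (Suc N) * frac (real k * t)"
      by (simp add: frac_ge_0)
    then show "real (b k) \<le> real (Suc N) * frac (real k * t)"
      and "real (Suc N) * frac (real k * t) < real (b k) + 1"
      unfolding b_def by linarith+
  qed
  have b_less: "b k \<in> {..N}" for k
  proof -
    have "real (Suc N) * frac (real k * t) < real (Suc N) * 1"
      by (intro mult_strict_left_mono) (auto simp: frac_lt_1)
    with b_le[of k] have "real (b k) < real (Suc N)"
      by (metis le_less_trans mult_1_right)
    then show ?thesis
      by simp
  qed
  show thesis
  proof (cases "inj_on b {..N}")
    \<comment> \<open>There are as many multiples \<open>k = 0, ..., N\<close> as boxes, so without
      a collision the last box is hit, and that multiple lies at most \<open>1 / (N + 1)\<close>
      below an integer. It is not \<open>k = 0\<close>, which lies in box \<open>0\<close>.\<close>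
    case True
    then have "b ` {..N} = {..N}"
      using b_less by (intro endo_inj_surj) auto
    then obtain k where k: "k \<le> N" "b k = N"
      by (metis atMost_iff imageE order_refl)
    have "b 0 = 0"
      by (simp add: b_def)
    with k assms have "k \<noteq> 0"
      by (metis less_irrefl)
    moreover have "\<bar>real k * t - of_int (\<lfloor>real k * t\<rfloor> + 1)\<bar> \<le> 1 / real (Suc N)"
    proof -
      have "\<bar>real k * t - of_int (\<lfloor>real k * t\<rfloor> + 1)\<bar> = 1 - frac (real k * t)"
        using frac_lt_1[of "real k * t"] by (simp add: frac_def)
      also have "\<dots> \<le> 1 / real (Suc N)"
        using b_le[of k] k by (simp add: field_simps)
      finally show ?thesis .
    qed
    ultimately show thesis
      using k by (intro that[of k "\<lfloor>real k * t\<rfloor> + 1"]) auto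
  next
    \<comment> \<open>Two multiples share a box, so their difference \<open>(j - i) * t\<close> is
      close to an integer.\<close>
    case False
    then obtain i j where ij: "i < j" "j \<le> N" "b i = b j"
      unfolding inj_on_def by (metis atMost_iff linorder_neqE_nat)
    have "\<bar>real (Suc N) * frac (real j * t) - real (Suc N) * frac (real i * t)\<bar> \<le> 1"
      using b_le[of i] b_gt[of i] b_le[of j] b_gt[of j] ij(3) by simp
    then have "real (Suc N) * \<bar>frac (real j * t) - frac (real i * t)\<bar> \<le> 1"
      by (simp add: right_diff_distrib[symmetric] abs_mult)
    then have "\<bar>frac (real j * t) - frac (real i * t)\<bar> \<le> 1 / real (Suc N)"
      by (simp add: field_simps)
    moreover have "real (j - i) * t - of_int (\<lfloor>real j * t\<rfloor> - \<lfloor>real i * t\<rfloor>)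
        = frac (real j * t) - frac (real i * t)"
      using ij by (simp add: frac_def of_nat_diff algebra_simps)
    ultimately show thesis
      using ij by (intro that[of "j - i" "\<lfloor>real j * t\<rfloor> - \<lfloor>real i * t\<rfloor>"]) auto
  qed
qed

lemma residue_mod_30_cases:
  fixes m :: int
  obtains v where "v \<in> {1..15::nat}" "30 dvd int v * m"
  | v where "v \<in> {6..29} \<union> {31::nat}" "30 dvd int v * m + 1"
proof (cases "coprime m 30")
  case True
  then obtain u w where uw: "u * m + w * 30 = 1"
    by (metis bezout_int coprime_imp_gcd_eq_1)
  define x where "x = (- u) mod 30"
  define q where "q = (- u) div 30"
  have "- u = 30 * q + x"
    by (simp add: x_def q_def)
  then have "x * m + 1 = (- u - 30 * q) * m + (u * m + w * 30)"
    using uw by simp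
  also have "\<dots> = 30 * (w - q * m)"
    by (simp add: algebra_simps)
  finally have x: "x * m + 1 = 30 * (w - q * m)" .
  \<comment> \<open>Each of these shares a factor with 30, whereas \<open>x * m\<close> is -1 modulo
    30.\<close>
  have "x \<notin> {0, 2, 3, 4, 5}"
  proof
    assume "x \<in> {0, 2, 3, 4, 5}"
    then consider "x = 0" | "x = 2" | "x = 3" | "x = 4" | "x = 5"
      by blast
    then show False
      using x by cases (simp_all, presburger+)
  qed
  moreover have "0 \<le> x" "x < 30"
    by (simp_all add: x_def)
  ultimately consider "x = 1" | "6 \<le> x" "x < 30"
    by fastforce
  then show thesis
  proof cases
    \<comment> \<open>The speed 1 would be too small for the later estimate; 31 is in the same
      residue class.\<close>
    case 1
    with x have "int 31 * m + 1 = 30 * (w - q * m + m)"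
      by simp
    then have "30 dvd int 31 * m + 1"
      by (rule dvdI)
    then show thesis
      by (intro that(2)[of 31]) auto
  next
    case 2
    with x show thesis
      by (intro that(2)[of "nat x"]) auto
  qed
next
  case False
  \<comment> \<open>The witness is \<open>30 / g\<close>, which is at most 15 because
    \<open>g\<close> is at least 2.\<close>
  define g where "g = gcd m 30"
  obtain m' h where mh: "m = g * m'" "30 = g * h"
    by (metis dvdE g_def gcd_dvd1 gcd_dvd2)
  have "0 < g" "g \<noteq> 1"
    using False by (auto simp: g_def coprime_iff_gcd_eq_1)
  then have "2 \<le> g"
    by linarith
  moreover have "0 < h"
    using mh(2) \<open>0 < g\<close> by (metis zero_less_mult_pos zero_less_numeral)
  ultimately have "2 * h \<le> 30"
    unfolding mh(2) by (intro mult_right_mono) auto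
  moreover have "h * m = 30 * m'"
    unfolding mh by simp
  ultimately show thesis
    using \<open>0 < h\<close> by (intro that(1)[of "nat h"]) auto
qed

lemma close_speed_if_close_30:
  fixes t e :: real and m :: int
  assumes t: "30 * t = of_int m + e" and e: "0 \<le> e" "e \<le> 1 / 32"
  shows "\<exists>v\<in>{1..29} \<union> {31, 90::nat}. dist_int (real v * t) \<le> 1 / 32"
proof (cases "e \<le> 1 / 96")
  case True
  \<comment> \<open>Tripling gives \<open>90 * t = 3 * m + 3 * e\<close>, and the case bound makes
    \<open>3 * e\<close> at most \<open>1 / 32\<close>.\<close>
  have "dist_int (real 90 * t) \<le> 1 / 32"
    by (rule dist_int_le[where k = "3 * m"]) (use t e True in simp)
  then show ?thesis
    by blast
next
  case False
  show ?thesis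
  proof (rule residue_mod_30_cases[of m])
    fix v :: nat
    assume v: "v \<in> {1..15}" and "30 dvd int v * m"
    then obtain k where "int v * m = 30 * k"
      by blast
    then have k: "real v * of_int m = 30 * of_int k"
      by (metis of_int_mult of_int_numeral of_int_of_nat_eq)
    have "30 * (real v * t) = real v * of_int m + real v * e"
      using arg_cong[OF t, of "\<lambda>x. real v * x"] by (simp add: algebra_simps)
    then have "real v * t - of_int k = real v * e / 30"
      using k by simp
    then have "\<bar>real v * t - of_int k\<bar> = real v * e / 30"
      using e(1) by (simp only: abs_divide abs_mult abs_of_nat abs_numeral abs_of_nonneg)
    moreover have "real v * e \<le> 15 * (1 / 32)"
      using v e by (intro mult_mono) auto
    ultimately have "dist_int (real v * t) \<le> 1 / 32"
      by (intro dist_int_le[where k = k]) linarith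
    then show ?thesis
      using v by (intro bexI[of _ v]) auto
  next
    fix v :: nat
    assume v: "v \<in> {6..29} \<union> {31}" and "30 dvd int v * m + 1"
    then obtain k where "int v * m + 1 = 30 * k"
      by blast
    then have k: "real v * of_int m + 1 = 30 * of_int k"
      by (metis of_int_add of_int_1 of_int_mult of_int_numeral of_int_of_nat_eq)
    have "30 * (real v * t) = real v * of_int m + real v * e"
      using arg_cong[OF t, of "\<lambda>x. real v * x"] by (simp add: algebra_simps)
    then have "real v * t - of_int k = (real v * e - 1) / 30"
      using k by simp
    \<comment> \<open>The constants match exactly: \<open>v * e = 1 / 16\<close> would give
      \<open>(v * e - 1) / 30 = - 1 / 32\<close>. The upper bound below keeps
      \<open>v * e - 1\<close> negative.\<close>
    moreover have "6 * (1 / 96) \<le> real v * e"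
      using v e False by (intro mult_mono) auto
    moreover have "real v * e \<le> 31 * (1 / 32)"
      using v e by (intro mult_mono) auto
    ultimately have "\<bar>real v * t - of_int k\<bar> \<le> 1 / 32"
      unfolding abs_le_iff by simp
    then have "dist_int (real v * t) \<le> 1 / 32"
      by (rule dist_int_le)
    then show ?thesis
      using v by (intro bexI[of _ v]) auto
  qed
qed

lemma close_speed_exists:
  fixes t :: real
  shows "\<exists>v\<in>{1..29} \<union> {31, 90::nat}. dist_int (real v * t) \<le> 1 / 32"
proof -
  obtain k m where k: "k \<in> {1..31}" "\<bar>real k * t - of_int m\<bar> \<le> 1 / 32"
    using Dirichlet_approx_Suc[of 31 t] by auto
  define e where "e = 30 * t - of_int m"
  \<comment> \<open>Among \<open>1, ..., 31\<close> only 30 is not a speed. A negative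
    \<open>e\<close> is reduced to a positive one by replacing \<open>t\<close> with
    \<open>- t\<close>.\<close>
  consider "k \<noteq> 30" | "k = 30" "0 \<le> e" | "k = 30" "e \<le> 0"
    by linarith
  then show ?thesis
  proof cases
    case 1
    then have "k \<in> {1..29} \<union> {31, 90}"
      using k(1) by auto
    then show ?thesis
      using dist_int_le[OF k(2)] by blast
  next
    case 2
    then show ?thesis
      using k(2) by (intro close_speed_if_close_30[of t m e]) (auto simp: e_def)
  next
    case 3
    then have "\<exists>v\<in>{1..29} \<union> {31, 90::nat}. dist_int (real v * - t) \<le> 1 / 32"
      using k(2) by (intro close_speed_if_close_30[of "- t" "- m" "- e"]) (auto simp: e_def)
    then show ?thesis
      by (simp only: mult_minus_right dist_int_minus)
  qed
qed

theorem proposition1p9: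
  fixes n :: nat and V :: "nat set"
  assumes "n = 32" and "V = {1..29} \<union> {31, 90}"
  shows "speed_set n V \<and> card V = n - 1 \<and> card V = 31 \<and> tight n V \<and> LR V = 1 / 32
    \<and> Max V = 90 \<and> Max V > 2 * n"
proof -
  have fin: "finite V" "V \<noteq> {}"
    using assms(2) by auto
  have card: "card V = 31"
    unfolding assms(2) by (subst card_Un_disjoint) auto
  have max: "Max V = 90"
    by (rule Max_eqI) (use assms(2) in auto)
  have LR: "LR V = 1 / 32"
  proof (rule antisym)
    obtain t where t: "LR V = (MIN v\<in>V. dist_int (real v * t))"
      using LR_attained(1)[OF fin] by blast
    obtain v where "v \<in> V" "dist_int (real v * t) \<le> 1 / 32"
      using close_speed_exists[of t] assms(2) by blast
    then show "LR V \<le> 1 / 32"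
      unfolding t using fin by (meson Min_le finite_imageI imageI order_trans)
  next
    \<comment> \<open>The time \<open>1 / 32\<close> attains the bound, since no speed is a multiple
      of 32.\<close>
    have "1 / 32 \<le> dist_int (real v * (1 / 32))" if "v \<in> V" for v
    proof -
      have "\<not> 32 dvd v"
        using that assms(2) by (auto dest: dvd_imp_le)
      then show ?thesis
        using dist_int_fraction_ge[of 32 v] by simp
    qed
    then have "1 / 32 \<le> (MIN v\<in>V. dist_int (real v * (1 / 32)))"
      using fin by (intro Min.boundedI) blast+
    also have "\<dots> \<le> LR V"
      by (rule LR_attained(2)[OF fin]) simp
    finally show "1 / 32 \<le> LR V" .
  qed
  have "speed_set n V"
    using card assms fin by (auto simp: speed_set_def)
  then show ?thesis
    using card max LR assms(1) by (simp add: tight_def)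
qed

end
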